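(* Let $\phi:\{1,\dots,n-1\} \to \mathbb{R}$ be a given function. Then the unique function $f:\bar{R}(l,n) \to \mathbb{R}$ satisfying $$\Delta f(x,y) = 0 \text{ in } R(l,n),$$ $$f(x,y) = \begin{cases} \phi(y) & \text{on } \{(l,y):1\leq y \leq n-1\},\\ 0 & \text{on } \partial R(l,n) \setminus \{(l,y):1\leq y \leq n-1\},\end{cases}$$ is given by $$f(x,y) = \sum_{j=1}^{n-1}b_j(\phi)\frac{\sinh(a_jx)}{\sinh(a_jl)}\sin\Big(\frac{\pi yj}{n}\Big),$$ where $a_j$ is the positive solution of $\cosh(a_j) = 2 - \cos(\frac{\pi j}{n})$ and $$b_j(\phi)=\frac{2}{n-1}\sum_{y=1}^{n-1}\phi(y)\sin\Big(\frac{\pi yj}{n}\Big).$$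
   Context: Here $l$ and $n$ are integers and $R(l,n)=\{(x,y) \in \mathbb{Z}^2:1\leq x\leq l-1,\ 1\leq y \leq n-1\}$ is the discrete rectangle. The boundary of a set $D\subset\mathbb{Z}^2$ is $\partial D=\{w\in\mathbb{Z}^2: w\notin D,\ \exists z\in D \text{ with } |z-w|=1\}$ ($|\cdot|$ the Euclidean norm), and $\bar{R}(l,n)=R(l,n)\cup\partial R(l,n)$. The discrete Laplacian is $\Delta f(x,y)=\frac14\sum (f(x',y')-f(x,y))$, the sum being over the four $(x',y')\in\mathbb{Z}^2$ with $|(x',y')-(x,y)|=1$.
   Formalization: The coefficient b_j(φ) is taken with the factor 2/n instead of the printed 2/(n-1); with the printed factor the boundary condition fails, e.g. for n = 2 the formula gives f(l,1) = 2φ(1) instead of φ(1). *)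

theory Defs
  imports "HOL-Analysis.Analysis"
begin

(* The norm on real * real in HOL-Analysis is the Euclidean one. *)
definition lattice_dist :: "int \<times> int \<Rightarrow> int \<times> int \<Rightarrow> real" where
  "lattice_dist z w =
     norm (real_of_int (fst z - fst w), real_of_int (snd z - snd w))"

definition rect :: "int \<Rightarrow> int \<Rightarrow> (int \<times> int) set" where
  "rect l n = {(x, y). 1 \<le> x \<and> x \<le> l - 1 \<and> 1 \<le> y \<and> y \<le> n - 1}"

definition bdry :: "(int \<times> int) set \<Rightarrow> (int \<times> int) set" where
  "bdry D = {w. w \<notin> D \<and> (\<exists>z\<in>D. lattice_dist z w = 1)}"

definition rect_closure :: "int \<Rightarrow> int \<Rightarrow> (int \<times> int) set" where
  "rect_closure l n = rect l n \<union> bdry (rect l n)"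

definition discrete_laplacian :: "(int \<times> int \<Rightarrow> real) \<Rightarrow> int \<times> int \<Rightarrow> real" where
  "discrete_laplacian f z = 1 / 4 * (\<Sum>z' | lattice_dist z' z = 1. f z' - f z)"

definition right_side :: "int \<Rightarrow> int \<Rightarrow> (int \<times> int) set" where
  "right_side l n = {(l, y) | y. 1 \<le> y \<and> y \<le> n - 1}"

(* Only the values of f on rect_closure l n and of phi on {1..n - 1} matter.
   If l < 2 or n < 2, the rectangle and its boundary are empty. *)
definition dirichlet_solution ::
    "int \<Rightarrow> int \<Rightarrow> (int \<Rightarrow> real) \<Rightarrow> (int \<times> int \<Rightarrow> real) \<Rightarrow> bool" where
  "dirichlet_solution l n \<phi> f \<longleftrightarrow>
     (\<forall>z\<in>rect l n. discrete_laplacian f z = 0) \<and>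
     (\<forall>z\<in>bdry (rect l n). f z = (if z \<in> right_side l n then \<phi> (snd z) else 0))"

definition a_coeff :: "int \<Rightarrow> int \<Rightarrow> real" where
  "a_coeff n j = (THE a. a > 0 \<and> cosh a = 2 - cos (pi * of_int j / of_int n))"

(* The normalisation is 2 / n because the squares of sin (pi * y * j / n) over
   1 <= y <= n - 1 sum to n / 2.  The source prints 2 / (n - 1), with which the
   boundary condition on the right side fails: for n = 2 the resulting function
   takes the value 2 * phi 1 at (l, 1). *)
definition b_coeff :: "int \<Rightarrow> (int \<Rightarrow> real) \<Rightarrow> int \<Rightarrow> real" where
  "b_coeff n \<phi> j =
     2 / of_int n * (\<Sum>y = 1..n - 1. \<phi> y * sin (pi * of_int y * of_int j / of_int n))"

end

theory Submission
  imports Defs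
begin

text \<open>
  Each product \<open>sinh (a\<^sub>j x) sin (\<pi> y j / n)\<close> is discrete harmonic because
  \<open>cosh a\<^sub>j + cos (\<pi> j / n) = 2\<close>, and it vanishes on the lines \<open>x = 0\<close>, \<open>y = 0\<close> and \<open>y = n\<close>.
  Discrete orthogonality of the sines shows that the coefficients \<open>b\<^sub>j\<close> reproduce \<open>\<phi>\<close> on the
  line \<open>x = l\<close>. Uniqueness is the maximum principle: if a harmonic function has a positive
  maximum, then it attains that maximum at a rightmost point, which cannot be interior.
\<close>

section \<open>Lattice neighbours and the boundary of the rectangle\<close>

lemma lattice_dist_commute: "lattice_dist z w = lattice_dist w z"
  by (simp add: lattice_dist_def norm_Pair power2_commute)

lemma int_sum_squares_eq_1_iff:
  fixes a b :: int
  shows "a\<^sup>2 + b\<^sup>2 = 1 \<longleftrightarrow> (\<bar>a\<bar> = 1 \<and> b = 0) \<or> (a = 0 \<and> \<bar>b\<bar> = 1)"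
proof
  assume *: "a\<^sup>2 + b\<^sup>2 = 1"
  have "a\<^sup>2 \<le> 1" "b\<^sup>2 \<le> 1"
    using * zero_le_power2[of a] zero_le_power2[of b] by linarith+
  then have "\<bar>a\<bar> \<le> 1" "\<bar>b\<bar> \<le> 1"
    by (simp_all add: abs_square_le_1)
  then have "a \<in> {-1, 0, 1}" "b \<in> {-1, 0, 1}"
    by auto
  with * show "(\<bar>a\<bar> = 1 \<and> b = 0) \<or> (a = 0 \<and> \<bar>b\<bar> = 1)"
    by auto
qed (auto simp: abs_if split: if_splits)

lemma lattice_dist_eq_1_iff:
  "lattice_dist z (x, y) = 1 \<longleftrightarrow> z \<in> {(x + 1, y), (x - 1, y), (x, y + 1), (x, y - 1)}"
proof (cases z)
  case (Pair u v)
  have "lattice_dist z (x, y) = 1 \<longleftrightarrow> real_of_int ((u - x)\<^sup>2 + (v - y)\<^sup>2) = 1"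
    by (simp add: Pair lattice_dist_def norm_Pair)
  also have "\<dots> \<longleftrightarrow> (u - x)\<^sup>2 + (v - y)\<^sup>2 = 1"
    by (rule of_int_eq_1_iff)
  also have "\<dots> \<longleftrightarrow> z \<in> {(x + 1, y), (x - 1, y), (x, y + 1), (x, y - 1)}"
    unfolding int_sum_squares_eq_1_iff Pair by auto
  finally show ?thesis .
qed

lemma discrete_laplacian_eq:
  "discrete_laplacian f (x, y) =
     (f (x + 1, y) + f (x - 1, y) + f (x, y + 1) + f (x, y - 1)) / 4 - f (x, y)"
proof -
  have "{z'. lattice_dist z' (x, y) = 1} = {(x + 1, y), (x - 1, y), (x, y + 1), (x, y - 1)}"
    using lattice_dist_eq_1_iff by blast
  then show ?thesis
    by (simp add: discrete_laplacian_def field_simps)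
qed

text \<open>The four corners are missing because no point of the rectangle is at distance 1 from
  them. The bounds on \<open>l\<close> and \<open>n\<close> say that the rectangle is nonempty;
  otherwise there is no boundary either.\<close>

lemma bdry_rect_iff:
  "(x, y) \<in> bdry (rect l n) \<longleftrightarrow>
     2 \<le> l \<and> 2 \<le> n \<and> ((x = 0 \<or> x = l) \<and> 1 \<le> y \<and> y \<le> n - 1 \<or>
                         (y = 0 \<or> y = n) \<and> 1 \<le> x \<and> x \<le> l - 1)"
proof -
  have "(x, y) \<in> bdry (rect l n) \<longleftrightarrow> (x, y) \<notin> rect l n \<and>
      ((x + 1, y) \<in> rect l n \<or> (x - 1, y) \<in> rect l n \<or> (x, y + 1) \<in> rect l n \<or> (x, y - 1) \<in> rect l n)"
    by (auto simp: bdry_def lattice_dist_eq_1_iff)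
  then show ?thesis
    unfolding rect_def mem_Collect_eq case_prod_conv by smt
qed

lemma neighbours_in_rect_closure:
  assumes "(x, y) \<in> rect l n"
  shows "{(x + 1, y), (x - 1, y), (x, y + 1), (x, y - 1)} \<subseteq> rect_closure l n"
proof
  fix w assume "w \<in> {(x + 1, y), (x - 1, y), (x, y + 1), (x, y - 1)}"
  then have "lattice_dist (x, y) w = 1"
    by (simp add: lattice_dist_commute[of _ w] lattice_dist_eq_1_iff)
  with assms show "w \<in> rect_closure l n"
    by (auto simp: rect_closure_def bdry_def)
qed

lemma rect_closure_subset: "rect_closure l n \<subseteq> {0..l} \<times> {0..n}"
proof
  fix z assume "z \<in> rect_closure l n"
  moreover obtain x y where z: "z = (x, y)"
    by (cases z)
  ultimately consider "(x, y) \<in> rect l n" | "(x, y) \<in> bdry (rect l n)"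
    by (auto simp: rect_closure_def)
  then show "z \<in> {0..l} \<times> {0..n}"
  proof cases
    case 1
    then show ?thesis
      by (simp add: z rect_def)
  next
    case 2
    then show ?thesis
      unfolding bdry_rect_iff z by auto
  qed
qed

lemma finite_rect_closure: "finite (rect_closure l n)"
  by (rule finite_subset[OF rect_closure_subset]) simp

lemma discrete_laplacian_cong:
  assumes "z \<in> rect l n" "\<And>w. w \<in> rect_closure l n \<Longrightarrow> f w = g w"
  shows "discrete_laplacian f z = discrete_laplacian g z"
proof (cases z)
  case (Pair x y)
  have "(x, y) \<in> rect_closure l n"
    using assms(1) Pair by (simp add: rect_closure_def)
  then show ?thesis
    using neighbours_in_rect_closure[of x y l n] assms Pair by (simp add: discrete_laplacian_eq)
qed

text \<open>All neighbours of an interior point lie in \<open>rect_closure l n\<close>, so values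
  elsewhere are invisible. This lets a solution on the whole lattice be cut down to the closed
  rectangle.\<close>

lemma dirichlet_solution_cong:
  assumes "\<And>w. w \<in> rect_closure l n \<Longrightarrow> f w = g w"
  shows "dirichlet_solution l n \<phi> f \<longleftrightarrow> dirichlet_solution l n \<phi> g"
  using discrete_laplacian_cong[of _ l n f g] assms
  by (auto simp: dirichlet_solution_def rect_closure_def)

section \<open>Maximum principle and uniqueness\<close>

lemma discrete_maximum_principle:
  assumes harm: "\<And>z. z \<in> rect l n \<Longrightarrow> discrete_laplacian h z = 0"
    and bd: "\<And>z. z \<in> bdry (rect l n) \<Longrightarrow> h z \<le> 0"
    and z: "z \<in> rect_closure l n"
  shows "h z \<le> 0"
proof -
  define M where "M = Max (h ` rect_closure l n)"
  have le_M: "h w \<le> M" if "w \<in> rect_closure l n" for w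
    using that by (simp add: M_def finite_rect_closure)
  have "M \<in> h ` rect_closure l n"
    unfolding M_def using z finite_rect_closure by (intro Max_in) auto
  define S where "S = {w \<in> rect_closure l n. h w = M}"
  have "finite S" "S \<noteq> {}"
    using \<open>M \<in> _\<close> finite_rect_closure by (auto simp: S_def)
  \<comment> \<open>A maximiser with largest first coordinate, found by minimising the negated
    coordinate over the finite set \<open>S\<close>.\<close>
  then obtain w where w: "w \<in> S" and rightmost: "\<And>v. v \<in> S \<Longrightarrow> fst v \<le> fst w"
    using arg_min_if_finite[of S "\<lambda>v. - fst v"] by fastforce
  obtain x y where xy: "w = (x, y)"
    by (cases w)
  have "(x, y) \<notin> rect l n"
  proof
    assume inside: "(x, y) \<in> rect l n"
    note nb = neighbours_in_rect_closure[OF inside]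
    have "h (x + 1, y) \<le> M" "h (x - 1, y) \<le> M" "h (x, y + 1) \<le> M" "h (x, y - 1) \<le> M"
      using nb le_M by auto
    moreover have "(h (x + 1, y) + h (x - 1, y) + h (x, y + 1) + h (x, y - 1)) / 4 = M"
      using harm[OF inside] w by (simp add: discrete_laplacian_eq xy S_def)
    \<comment> \<open>Four numbers that are at most \<open>M\<close> and average to \<open>M\<close>
      all equal \<open>M\<close>; only the right neighbour matters here.\<close>
    ultimately have "h (x + 1, y) = M"
      by argo
    with nb have "(x + 1, y) \<in> S"
      by (simp add: S_def)
    from rightmost[OF this] show False
      by (simp add: xy)
  qed
  with w have "w \<in> bdry (rect l n)"
    by (simp add: S_def rect_closure_def xy)
  with bd have "h w \<le> 0" .
  with w le_M[OF z] show ?thesis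
    by (simp add: S_def)
qed

text \<open>The difference of two solutions is harmonic and vanishes on the boundary, so the maximum
  principle applies to it in both orders.\<close>

lemma dirichlet_solution_unique:
  assumes f: "dirichlet_solution l n \<phi> f" and g: "dirichlet_solution l n \<phi> g"
    and z: "z \<in> rect_closure l n"
  shows "f z = g z"
proof -
  have le: "u z \<le> v z" if "dirichlet_solution l n \<phi> u" "dirichlet_solution l n \<phi> v" for u v
  proof -
    have "u z - v z \<le> 0"
    proof (rule discrete_maximum_principle[OF _ _ z])
      fix w assume w: "w \<in> rect l n"
      have "discrete_laplacian (\<lambda>z. u z - v z) w = discrete_laplacian u w - discrete_laplacian v w"
        by (cases w) (simp add: discrete_laplacian_eq field_simps)
      with that w show "discrete_laplacian (\<lambda>z. u z - v z) w = 0"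
        by (simp add: dirichlet_solution_def)
    next
      fix w assume "w \<in> bdry (rect l n)"
      with that show "u w - v w \<le> 0"
        by (simp add: dirichlet_solution_def)
    qed
    then show ?thesis
      by simp
  qed
  from le[OF f g] le[OF g f] show ?thesis
    by simp
qed

section \<open>Separated harmonic functions\<close>

lemma a_coeff_properties:
  assumes "1 \<le> j" "j \<le> n - 1"
  shows a_coeff_pos: "0 < a_coeff n j"
    and cosh_a_coeff: "cosh (a_coeff n j) = 2 - cos (pi * of_int j / of_int n)"
proof -
  define c where "c = 2 - cos (pi * of_int j / of_int n)"
  have "0 < pi * of_int j / real_of_int n" "pi * of_int j / real_of_int n \<le> pi"
    using assms by (auto simp: field_simps)
  \<comment> \<open>The angle lies in (0, pi], where cosine is strictly below 1; hence
    \<open>c\<close> exceeds 1 and \<open>arcosh c\<close> is positive.\<close>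
  then have "cos (pi * of_int j / real_of_int n) < cos 0"
    by (intro cos_monotone_0_pi) auto
  then have "1 < c"
    by (simp add: c_def)
  then have "cosh (arcosh c) = c" "0 < arcosh c"
    by (simp_all add: cosh_arcosh_real arcosh_1[symmetric] arcosh_less_iff_real del: arcosh_1)
  have "\<exists>!a. a > 0 \<and> cosh a = c"
  proof (rule ex1I[of _ "arcosh c"])
    show "arcosh c > 0 \<and> cosh (arcosh c) = c"
      using \<open>cosh (arcosh c) = c\<close> \<open>0 < arcosh c\<close> by simp
    show "a = arcosh c" if "a > 0 \<and> cosh a = c" for a
      using that arcosh_cosh_real[of a] by auto
  qed
  from theI'[OF this] show "0 < a_coeff n j" "cosh (a_coeff n j) = 2 - cos (pi * of_int j / of_int n)"
    by (simp_all add: a_coeff_def c_def)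
qed

text \<open>By the addition formulas, adding the two horizontal neighbours multiplies the product by
  \<open>2 * cosh a\<close>, and adding the two vertical ones by \<open>2 * cos t\<close>. The
  assumption makes these factors sum to 4.\<close>

lemma sinh_sin_harmonic:
  fixes a t :: real and x y :: int
  assumes "cosh a = 2 - cos t"
  shows "discrete_laplacian (\<lambda>(x, y). sinh (a * of_int x) * sin (of_int y * t)) (x, y) = 0"
proof -
  have "sinh (a * (of_int x + 1)) + sinh (a * (of_int x - 1)) = 2 * cosh a * sinh (a * of_int x)"
    by (simp add: ring_distribs sinh_add sinh_diff)
  moreover have "sin ((of_int y + 1) * t) + sin ((of_int y - 1) * t) = 2 * cos t * sin (of_int y * t)"
    by (simp add: ring_distribs sin_add sin_diff)
  moreover have "(p + q) * s + p' * (r + r') = 4 * (p' * s)"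
    if "p + q = 2 * cosh a * p'" "r + r' = 2 * cos t * s" for p q r r' p' s :: real
    unfolding that assms by (simp add: algebra_simps)
  ultimately have "(sinh (a * (of_int x + 1)) + sinh (a * (of_int x - 1))) * sin (of_int y * t) +
      sinh (a * of_int x) * (sin ((of_int y + 1) * t) + sin ((of_int y - 1) * t)) =
      4 * (sinh (a * of_int x) * sin (of_int y * t))"
    by blast
  then show ?thesis
    by (simp add: discrete_laplacian_eq distrib_left distrib_right)
qed

section \<open>Discrete orthogonality of the sines\<close>

lemma sum_cos_int:
  fixes t :: real and k :: int
  assumes "0 \<le> k"
  shows "2 * sin (t / 2) * (\<Sum>j = 1..k. cos (of_int j * t)) = sin (of_int k * t + t / 2) - sin (t / 2)"
  using assms
proof (induction k rule: int_ge_induct)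
  case base
  then show ?case by simp
next
  case (step k)
  have "{1..k + 1} = insert (k + 1) {1..k}"
    using step.hyps by auto
  \<comment> \<open>The factor \<open>2 * sin (t / 2)\<close> turns each cosine into a difference of
    sines at consecutive half-integer multiples of \<open>t\<close>, so the sum telescopes.\<close>
  moreover have "2 * sin (t / 2) * cos (of_int (k + 1) * t) =
      sin (of_int (k + 1) * t + t / 2) - sin (of_int k * t + t / 2)"
  proof -
    have "of_int k * t + t / 2 = of_int (k + 1) * t - t / 2"
      by (simp add: field_simps)
    then show ?thesis
      by (simp only: sin_add sin_diff) simp
  qed
  ultimately show ?case
    using step.IH by (simp add: ring_distribs)
qed

text \<open>The value is -1 for even \<open>m\<close> and 0 for odd \<open>m\<close>, so it depends
  only on parity. The bounds on \<open>m\<close> keep \<open>t / 2\<close> nonzero and inside (-pi,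
  pi), so that \<open>sin (t / 2)\<close> can be cancelled.\<close>

lemma sum_cos_pi_fraction:
  fixes m n :: int
  assumes "1 \<le> n" "\<bar>m\<bar> < 2 * n" "m \<noteq> 0"
  shows "(\<Sum>j = 1..n - 1. cos (of_int j * (pi * of_int m / of_int n))) = - (1 + (if even m then 1 else -1)) / 2"
proof -
  define t where "t = pi * of_int m / real_of_int n"
  have "\<bar>t / 2\<bar> < pi" "t / 2 \<noteq> 0"
    using assms by (auto simp: t_def abs_mult field_simps)
  then have nz: "sin (t / 2) \<noteq> 0"
    by (metis abs_less_iff abs_minus_cancel linorder_neqE_linordered_idom neg_0_less_iff_less
        less_irrefl minus_equation_iff sin_gt_zero sin_minus)
  \<comment> \<open>Here \<open>n * t\<close> equals \<open>pi * m\<close>, so the upper end of the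
    telescoped sum is again \<open>sin (t / 2)\<close> up to sign.\<close>
  have "of_int (n - 1) * t + t / 2 = pi * of_int m - t / 2"
    using assms by (simp add: t_def field_simps)
  then have "sin (of_int (n - 1) * t + t / 2) = - (if even m then 1 else -1) * sin (t / 2)"
    by (simp only: sin_diff sin_npi_int cos_npi_int)
  with sum_cos_int[of "n - 1" t] assms
  have "2 * sin (t / 2) * (\<Sum>j = 1..n - 1. cos (of_int j * t)) =
      2 * sin (t / 2) * (- (1 + (if even m then 1 else -1)) / 2)"
    by (simp add: algebra_simps)
  with nz show ?thesis
    by (simp add: t_def)
qed

text \<open>The product formula leaves half the difference of the cosine sums at
  \<open>y - y'\<close> and \<open>y + y'\<close>. These integers have equal parity, so the sums
  cancel unless \<open>y = y'\<close>; then the sums are \<open>n - 1\<close> and -1.\<close>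

lemma discrete_sine_orthogonality:
  fixes n y y' :: int
  assumes y: "1 \<le> y" "y \<le> n - 1" and y': "1 \<le> y'" "y' \<le> n - 1"
  shows "(\<Sum>j = 1..n - 1. sin (pi * of_int y * of_int j / of_int n) *
            sin (pi * of_int y' * of_int j / of_int n)) = (if y = y' then of_int n / 2 else 0)"
proof -
  define C where "C m = (\<Sum>j = 1..n - 1. cos (of_int j * (pi * of_int m / of_int n)))" for m :: int
  have "(\<Sum>j = 1..n - 1. sin (pi * of_int y * of_int j / of_int n) *
            sin (pi * of_int y' * of_int j / of_int n)) = (C (y - y') - C (y + y')) / 2"
    unfolding C_def sum_subtractf[symmetric] sum_divide_distrib
    by (intro sum.cong refl)
       (simp add: sin_times_sin ring_distribs diff_divide_distrib add_divide_distrib mult_ac)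
  also have "\<dots> = (if y = y' then of_int n / 2 else 0)"
  proof (cases "y = y'")
    case True
    have "C (y - y') = of_int n - 1"
      using True y by (simp add: C_def)
    moreover have "C (y + y') = -1"
      unfolding C_def using sum_cos_pi_fraction[of n "y + y'"] y y' True by simp
    ultimately show ?thesis
      using True by simp
  next
    case False
    have "\<bar>y - y'\<bar> < 2 * n" "\<bar>y + y'\<bar> < 2 * n" "y - y' \<noteq> 0" "y + y' \<noteq> 0" "1 \<le> n"
      using y y' False by linarith+
    then have "C (y - y') = - (1 + (if even (y - y') then 1 else -1)) / 2"
      "C (y + y') = - (1 + (if even (y + y') then 1 else -1)) / 2"
      unfolding C_def by - (rule sum_cos_pi_fraction; assumption)+
    moreover have "even (y - y') \<longleftrightarrow> even (y + y')"
      by simp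
    ultimately have "C (y - y') = C (y + y')"
      by simp
    with False show ?thesis
      by simp
  qed
  finally show ?thesis .
qed

text \<open>After exchanging the sums, orthogonality in \<open>j\<close> keeps only the term
  \<open>y' = y\<close>, and the normalisation \<open>2 / n\<close> cancels its
  \<open>n / 2\<close>.\<close>

lemma b_coeff_inversion:
  assumes y: "1 \<le> y" "y \<le> n - 1"
  shows "(\<Sum>j = 1..n - 1. b_coeff n \<phi> j * sin (pi * of_int y * of_int j / of_int n)) = \<phi> y"
proof -
  let ?s = "\<lambda>y j. sin (pi * of_int y * of_int j / real_of_int n)"
  have "(\<Sum>j = 1..n - 1. b_coeff n \<phi> j * ?s y j) =
      (\<Sum>j = 1..n - 1. \<Sum>y' = 1..n - 1. 2 / of_int n * \<phi> y' * (?s y' j * ?s y j))"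
    unfolding b_coeff_def sum_distrib_left sum_distrib_right by (simp add: mult_ac)
  also have "\<dots> = (\<Sum>y' = 1..n - 1. \<Sum>j = 1..n - 1. 2 / of_int n * \<phi> y' * (?s y' j * ?s y j))"
    by (rule sum.swap)
  also have "\<dots> = (\<Sum>y' = 1..n - 1. 2 / of_int n * \<phi> y' * (if y' = y then of_int n / 2 else 0))"
    unfolding sum_distrib_left[symmetric]
    by (intro sum.cong refl) (use y in \<open>simp add: discrete_sine_orthogonality\<close>)
  also have "\<dots> = (\<Sum>y' = 1..n - 1. if y' = y then \<phi> y else 0)"
    using y by (intro sum.cong) auto
  also have "\<dots> = \<phi> y"
    using y by simp
  finally show ?thesis .
qed

section \<open>The sine series solves the boundary value problem\<close>

definition sine_series :: "int \<Rightarrow> int \<Rightarrow> (int \<Rightarrow> real) \<Rightarrow> int \<times> int \<Rightarrow> real" where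
  "sine_series l n \<phi> = (\<lambda>(x, y). \<Sum>j = 1..n - 1.
     b_coeff n \<phi> j * (sinh (a_coeff n j * of_int x) / sinh (a_coeff n j * of_int l))
       * sin (pi * of_int y * of_int j / of_int n))"

lemma discrete_laplacian_sum:
  "discrete_laplacian (\<lambda>z. \<Sum>j\<in>A. c j * u j z) z = (\<Sum>j\<in>A. c j * discrete_laplacian (u j) z)"
  by (cases z)
     (simp add: discrete_laplacian_eq right_diff_distrib distrib_left sum.distrib sum_subtractf
       sum_divide_distrib add_divide_distrib)

text \<open>Each summand is a constant multiple of a separated product, hence harmonic at every
  lattice point and not only in the rectangle.\<close>

lemma sine_series_harmonic: "discrete_laplacian (sine_series l n \<phi>) z = 0"
proof -
  define t where "t j = pi * of_int j / real_of_int n" for j :: int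
  have "sine_series l n \<phi> = (\<lambda>z. \<Sum>j = 1..n - 1. b_coeff n \<phi> j / sinh (a_coeff n j * of_int l) *
      (\<lambda>(x, y). sinh (a_coeff n j * of_int x) * sin (of_int y * t j)) z)"
    unfolding sine_series_def t_def by (auto simp: fun_eq_iff mult_ac)
  then have "discrete_laplacian (sine_series l n \<phi>) z =
      (\<Sum>j = 1..n - 1. b_coeff n \<phi> j / sinh (a_coeff n j * of_int l) *
        discrete_laplacian (\<lambda>(x, y). sinh (a_coeff n j * of_int x) * sin (of_int y * t j)) z)"
    by (simp only: discrete_laplacian_sum)
  moreover have
    "discrete_laplacian (\<lambda>(x, y). sinh (a_coeff n j * of_int x) * sin (of_int y * t j)) z = 0"
    if "j \<in> {1..n - 1}" for j
    using that sinh_sin_harmonic[of "a_coeff n j" "t j" "fst z" "snd z"] cosh_a_coeff[of j n]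
    by (simp add: t_def)
  ultimately show ?thesis
    by (simp only: mult_zero_right sum.neutral_const cong: sum.cong)
qed

lemma sine_series_right_side:
  assumes "2 \<le> l" "1 \<le> y" "y \<le> n - 1"
  shows "sine_series l n \<phi> (l, y) = \<phi> y"
proof -
  have "sinh (a_coeff n j * of_int l) \<noteq> 0" if "j \<in> {1..n - 1}" for j
    using that a_coeff_pos[of j n] assms by simp
  then have "sine_series l n \<phi> (l, y) =
      (\<Sum>j = 1..n - 1. b_coeff n \<phi> j * sin (pi * of_int y * of_int j / of_int n))"
    unfolding sine_series_def by simp
  with b_coeff_inversion assms show ?thesis
    by simp
qed

lemma sine_series_solution: "dirichlet_solution l n \<phi> (sine_series l n \<phi>)"
  unfolding dirichlet_solution_def
proof (intro conjI ballI)
  fix z assume "z \<in> bdry (rect l n)"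
  moreover obtain x y where z: "z = (x, y)"
    by (cases z)
  \<comment> \<open>The bound on \<open>l\<close> gives nonzero denominators on the right side and
    keeps \<open>x = 0\<close> off that side. The bound on \<open>n\<close> allows \<open>n\<close>
    to be cancelled in the sine at \<open>y = n\<close>.\<close>
  ultimately consider
      (right) "2 \<le> l" "x = l" "1 \<le> y" "y \<le> n - 1"
    | (left) "x = 0" "2 \<le> l"
    | (bottom) "y = 0" | (top) "y = n" "2 \<le> n"
    unfolding z bdry_rect_iff by blast
  then show "sine_series l n \<phi> z = (if z \<in> right_side l n then \<phi> (snd z) else 0)"
  proof cases
    case right
    then show ?thesis
      by (simp add: z sine_series_right_side right_side_def)
  next
    case top
    then have "sin (pi * of_int y * of_int j / real_of_int n) = 0" for j
      by simp
    with top show ?thesis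
      by (simp add: z sine_series_def right_side_def)
  qed (simp_all add: z sine_series_def right_side_def)
qed (rule sine_series_harmonic)

theorem lemma6p2:
  fixes l n :: int and \<phi> :: "int \<Rightarrow> real"
  shows "(\<exists>!f. f \<in> rect_closure l n \<rightarrow>\<^sub>E UNIV \<and> dirichlet_solution l n \<phi> f) \<and>
    (\<forall>f. dirichlet_solution l n \<phi> f \<longrightarrow>
      (\<forall>(x, y)\<in>rect_closure l n.
        f (x, y) = (\<Sum>j = 1..n - 1.
          b_coeff n \<phi> j * (sinh (a_coeff n j * of_int x) / sinh (a_coeff n j * of_int l))
            * sin (pi * of_int y * of_int j / of_int n))))"
proof
  \<comment> \<open>Restriction makes the series \<open>undefined\<close> off the closed rectangle,
    as membership in the extensional function space demands; without this, values there would be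
    arbitrary and uniqueness would fail.\<close>
  let ?f = "restrict (sine_series l n \<phi>) (rect_closure l n)"
  show "\<exists>!f. f \<in> rect_closure l n \<rightarrow>\<^sub>E UNIV \<and> dirichlet_solution l n \<phi> f"
  proof (rule ex1I[of _ ?f])
    have "dirichlet_solution l n \<phi> ?f"
      using sine_series_solution dirichlet_solution_cong[of l n ?f "sine_series l n \<phi>"] by simp
    then show "?f \<in> rect_closure l n \<rightarrow>\<^sub>E UNIV \<and> dirichlet_solution l n \<phi> ?f"
      by simp
    fix f assume f: "f \<in> rect_closure l n \<rightarrow>\<^sub>E UNIV \<and> dirichlet_solution l n \<phi> f"
    show "f = ?f"
    proof (rule PiE_ext)
      show "f \<in> rect_closure l n \<rightarrow>\<^sub>E UNIV" "?f \<in> rect_closure l n \<rightarrow>\<^sub>E UNIV"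
        using f by simp_all
      show "f z = ?f z" if "z \<in> rect_closure l n" for z
        using dirichlet_solution_unique[OF conjunct2[OF f] \<open>dirichlet_solution l n \<phi> ?f\<close> that] .
    qed
  qed
  show "\<forall>f. dirichlet_solution l n \<phi> f \<longrightarrow>
      (\<forall>(x, y)\<in>rect_closure l n.
        f (x, y) = (\<Sum>j = 1..n - 1.
          b_coeff n \<phi> j * (sinh (a_coeff n j * of_int x) / sinh (a_coeff n j * of_int l))
            * sin (pi * of_int y * of_int j / of_int n)))"
    using dirichlet_solution_unique[OF _ sine_series_solution] by (auto simp: sine_series_def)
qed

end
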